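(* Let $(G,\mathfrak{A})$ be an averaging group with identity element $e$. Define two binary operations on $G$ by $$g\dashv h:=g\,\mathfrak{A}(h),\qquad g\vdash h:=\mathfrak{A}(g)\,h\qquad (g,h\in G).$$ Then $(G,\dashv,\vdash)$ is a disemigroup. Moreover, if $\mathfrak{A}(e)=e$, then $(G,\dashv,\vdash)$ is a dimonoid.
   Context: An averaging group is a pair $(G,\mathfrak{A})$ where $G$ is a group and $\mathfrak{A}:G\to G$ is a map (not necessarily a homomorphism), called an averaging operator, such that $\mathfrak{A}(g)\mathfrak{A}(h)=\mathfrak{A}(\mathfrak{A}(g)h)=\mathfrak{A}(g\mathfrak{A}(h))$ for all $g,h\in G$. A disemigroup is a set $G$ with two binary operations $\dashv,\vdash:G\times G\to G$ such that for all $f,g,h\in G$: $(f\dashv g)\dashv h=f\dashv(g\dashv h)$; $(f\dashv g)\dashv h=f\dashv(g\vdash h)$; $(f\vdash g)\dashv h=f\vdash(g\dashv h)$; $(f\dashv g)\vdash h=f\vdash(g\vdash h)$; $(f\vdash g)\vdash h=f\vdash(g\vdash h)$. A dimonoid is a disemigroup $(G,\dashv,\vdash)$ for which there is an element $e\in G$ with $g\dashv e=g=e\vdash g$ for all $g\in G$. *)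

theory Defs
  imports "HOL-Algebra.Group"
begin

locale averaging_group = group G for G (structure) +
  fixes A :: "'a \<Rightarrow> 'a"
  assumes averaging_closed: "A \<in> carrier G \<rightarrow> carrier G"
    and averaging_left:
      "\<lbrakk>g \<in> carrier G; h \<in> carrier G\<rbrakk> \<Longrightarrow> A g \<otimes> A h = A (A g \<otimes> h)"
    and averaging_right:
      "\<lbrakk>g \<in> carrier G; h \<in> carrier G\<rbrakk> \<Longrightarrow> A g \<otimes> A h = A (g \<otimes> A h)"

locale disemigroup =
  fixes S :: "'a set"
    and left_op :: "'a \<Rightarrow> 'a \<Rightarrow> 'a" (infixl \<open>\<stileturn>\<close> 70)
    and right_op :: "'a \<Rightarrow> 'a \<Rightarrow> 'a" (infixl \<open>\<turnstile>\<close> 70)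
  assumes left_closed: "\<lbrakk>f \<in> S; g \<in> S\<rbrakk> \<Longrightarrow> f \<stileturn> g \<in> S"
    and right_closed: "\<lbrakk>f \<in> S; g \<in> S\<rbrakk> \<Longrightarrow> f \<turnstile> g \<in> S"
    and left_left_left:
      "\<lbrakk>f \<in> S; g \<in> S; h \<in> S\<rbrakk> \<Longrightarrow> (f \<stileturn> g) \<stileturn> h = f \<stileturn> (g \<stileturn> h)"
    and left_left_right:
      "\<lbrakk>f \<in> S; g \<in> S; h \<in> S\<rbrakk> \<Longrightarrow> (f \<stileturn> g) \<stileturn> h = f \<stileturn> (g \<turnstile> h)"
    and right_left_assoc:
      "\<lbrakk>f \<in> S; g \<in> S; h \<in> S\<rbrakk> \<Longrightarrow> (f \<turnstile> g) \<stileturn> h = f \<turnstile> (g \<stileturn> h)"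
    and left_right_right:
      "\<lbrakk>f \<in> S; g \<in> S; h \<in> S\<rbrakk> \<Longrightarrow> (f \<stileturn> g) \<turnstile> h = f \<turnstile> (g \<turnstile> h)"
    and right_right_right:
      "\<lbrakk>f \<in> S; g \<in> S; h \<in> S\<rbrakk> \<Longrightarrow> (f \<turnstile> g) \<turnstile> h = f \<turnstile> (g \<turnstile> h)"

locale dimonoid = disemigroup +
  assumes bar_unit: "\<exists>e\<in>S. \<forall>g\<in>S. g \<stileturn> e = g \<and> e \<turnstile> g = g"

end

theory Submission
  imports Defs
begin

text \<open>
  The averaging identity says that an \<^term>\<open>A\<close> wrapped around a product containing a value of
  \<^term>\<open>A\<close> splits off: both \<open>A (A g \<otimes> h)\<close> and \<open>A (g \<otimes> A h)\<close> are \<open>A g \<otimes> A h\<close>. Hence either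
  bracketing in a disemigroup law expands to the same product of three factors, in which all
  but one carry an \<^term>\<open>A\<close>; the bare factor is the one at which both operations point. The
  mixed law, whose bare factor is in the middle, is plain associativity in the group. If
  \<^term>\<open>A\<close> fixes the identity of the group, that identity is a bar-unit.
\<close>

theorem proposition3p8:
  fixes G :: "('a, 'b) monoid_scheme" (structure)
    and A :: "'a \<Rightarrow> 'a"
  assumes "averaging_group G A"
  shows "disemigroup (carrier G) (\<lambda>g h. g \<otimes> A h) (\<lambda>g h. A g \<otimes> h) \<and>
    (A \<one> = \<one> \<longrightarrow> dimonoid (carrier G) (\<lambda>g h. g \<otimes> A h) (\<lambda>g h. A g \<otimes> h))"
proof -
  interpret averaging_group G A by (fact assms)
  have closed: "A g \<in> carrier G" if "g \<in> carrier G" for g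
    using averaging_closed that by auto
  have dis: "disemigroup (carrier G) (\<lambda>g h. g \<otimes> A h) (\<lambda>g h. A g \<otimes> h)"
    by unfold_locales
      (simp_all add: closed m_assoc averaging_left [symmetric] averaging_right [symmetric])
  moreover have "dimonoid (carrier G) (\<lambda>g h. g \<otimes> A h) (\<lambda>g h. A g \<otimes> h)" if "A \<one> = \<one>"
    using that by (intro dimonoid.intro dis dimonoid_axioms.intro bexI [of _ \<one>]) simp_all
  ultimately show ?thesis by blast
qed

end
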